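(* Let $T=(V,E)$ be a tree with $n=|V|\ge 2$ vertices. Then $\ell(T)=2n-2$.
   Context: A word $w$ over the alphabet $V$ word-represents a graph $G=(V,E)$ if $w$ contains every letter of $V$ at least once and for all distinct $x,y\in V$, $xy\in E$ if and only if $x$ and $y$ alternate in $w$ (the subword of $w$ consisting only of occurrences of $x$ and $y$ has no two equal consecutive letters). For a graph admitting such a word, $\ell(G)$ is the minimum length of a word that word-represents $G$. *)

theory Defs
  imports "Graph_Theory.Graph_Theory"
begin

text \<open>
  Finite simple graphs are rendered by the locale \<^locale>\<open>pair_graph\<close>: finite, loop-free,
  symmetric, with the edge \<open>xy\<close> given by the two arcs \<open>(x, y)\<close> and \<open>(y, x)\<close>.
  The library's \<^const>\<open>forest\<close> and \<^const>\<open>tree\<close> are directed notions and unsuitable here, since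
  \<open>x, y, x\<close> counts as a \<^const>\<open>pre_digraph.cycle\<close> in a symmetric digraph. In the absence of loops
  and parallel arcs, the cycles of the undirected graph are exactly those of length at least 3.
\<close>

definition undirected_forest :: "'a pair_pre_digraph \<Rightarrow> bool" where
  "undirected_forest G \<longleftrightarrow>
     pair_graph G \<and> \<not> (\<exists>p. pre_digraph.cycle (with_proj G) p \<and> 3 \<le> length p)"

definition undirected_tree :: "'a pair_pre_digraph \<Rightarrow> bool" where
  "undirected_tree G \<longleftrightarrow> undirected_forest G \<and> Digraph_Component.connected (with_proj G)"

definition alternate :: "'a list \<Rightarrow> 'a \<Rightarrow> 'a \<Rightarrow> bool" where
  "alternate w x y \<longleftrightarrow> distinct_adj (filter (\<lambda>z. z = x \<or> z = y) w)"

definition word_represents :: "'a list \<Rightarrow> 'a pair_pre_digraph \<Rightarrow> bool" where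
  "word_represents w G \<longleftrightarrow>
     set w = pverts G \<and>
     (\<forall>x\<in>pverts G. \<forall>y\<in>pverts G. x \<noteq> y \<longrightarrow> ((x, y) \<in> parcs G \<longleftrightarrow> alternate w x y))"

definition word_representable :: "'a pair_pre_digraph \<Rightarrow> bool" where
  "word_representable G \<longleftrightarrow> (\<exists>w. word_represents w G)"

text \<open>Only meaningful if \<^term>\<open>word_representable G\<close>; otherwise the value is unspecified.\<close>

definition min_word_length :: "'a pair_pre_digraph \<Rightarrow> nat" where
  "min_word_length G = (LEAST k. \<exists>w. word_represents w G \<and> length w = k)"

end

theory Submission
  imports Defs
begin

text \<open>
  Two letters that occur only once in a word alternate, so in a representation of a tree they are
  adjacent, and at most two letters occur only once as a tree has no triangle; this gives
  \<open>2 n - 2\<close> as a lower bound. Conversely, start with the word \<open>a b\<close> for an edge \<open>ab\<close> and grow the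
  tree leaf by leaf: a new leaf \<open>v\<close> attached to \<open>u\<close> is accommodated by replacing the first \<open>u\<close> with
  \<open>v u v\<close>. As \<open>u\<close> occurs at most twice, \<open>v\<close> alternates with \<open>u\<close>, and since nothing but \<open>u\<close> separates
  the two copies of \<open>v\<close>, it alternates with no other letter.
\<close>

section \<open>Alternating letters\<close>

lemma distinct_adj_if_distinct: "distinct xs \<Longrightarrow> distinct_adj xs"
  by (auto simp: distinct_adj_conv_nth nth_eq_iff_index_eq)

lemma count_list_filter: "count_list (filter P xs) x = (if P x then count_list xs x else 0)"
  by (induction xs) auto

lemma distinct_if_count_list_le_1: "(\<And>x. count_list xs x \<le> 1) \<Longrightarrow> distinct xs"
proof (induction xs)
  case (Cons a xs)
  have "count_list xs a = 0"
    using Cons.prems[of a] by simp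
  moreover have "count_list xs x \<le> 1" for x
    using Cons.prems[of x] by (auto split: if_splits)
  ultimately show ?case
    using Cons.IH by (simp add: count_list_0_iff)
qed simp

lemma alternate_commute: "alternate w x y \<longleftrightarrow> alternate w y x"
  by (simp add: alternate_def disj_commute)

lemma alternate_if_count_list_eq_1:
  assumes "count_list w x = 1" and "count_list w y = 1"
  shows "alternate w x y"
  unfolding alternate_def
  by (intro distinct_adj_if_distinct distinct_if_count_list_le_1)
    (use assms in \<open>auto simp: count_list_filter\<close>)

lemma alternate_pair: "a \<noteq> b \<Longrightarrow> alternate [a, b] a b"
  by (simp add: alternate_def)

lemma filter_le_one_cases:
  assumes "count_list xs u \<le> 1"
  shows "filter (\<lambda>z. z = u) xs = [] \<or> filter (\<lambda>z. z = u) xs = [u]"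
  using assms by (induction xs) (auto simp: filter_empty_conv count_list_0_iff split: if_splits)

text \<open>Erasing all letters but \<open>u\<close> and \<open>v\<close> leaves
  \<open>v u v\<close> or \<open>v u v u\<close>: nothing remains of \<open>A\<close>, and
  \<open>B\<close> keeps at most one \<open>u\<close>.\<close>

lemma alternate_leaf:
  assumes "v \<notin> set (A @ u # B)" and "u \<notin> set A" and "count_list B u \<le> 1"
  shows "alternate (A @ v # u # v # B) v u"
proof -
  have "filter (\<lambda>z. z = v \<or> z = u) A = []"
    using assms by (auto simp: filter_empty_conv)
  moreover have "filter (\<lambda>z. z = v \<or> z = u) B = filter (\<lambda>z. z = u) B"
    using assms by (intro filter_cong) auto
  ultimately show ?thesis
    using assms filter_le_one_cases[OF assms(3)] by (auto simp: alternate_def)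
qed

text \<open>Once \<open>u\<close> is erased, the two displayed copies of \<open>v\<close> become
  neighbours.\<close>

lemma not_alternate_leaf:
  assumes "x \<noteq> u" and "v \<noteq> u"
  shows "\<not> alternate (A @ v # u # v # B) v x"
  using assms by (auto simp: alternate_def distinct_adj_append_iff)

lemma alternate_insert_leaf:
  assumes "x \<noteq> v" and "y \<noteq> v"
  shows "alternate (A @ v # u # v # B) x y \<longleftrightarrow> alternate (A @ u # B) x y"
  using assms by (simp add: alternate_def)

section \<open>Arcs leaving a set and linked sets\<close>

lemma rtrancl_crossing_pair:
  assumes "(a, b) \<in> r\<^sup>*" and "a \<in> S" and "b \<notin> S"
  obtains s v where "(s, v) \<in> r" "s \<in> S" "v \<notin> S"
  using assms by (induction rule: rtrancl_induct) blast+

text \<open>The relation is restricted to \<open>S\<close> so that the connecting walks stay inside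
  \<open>S\<close>; a vertex outside \<open>S\<close> can then close such a walk to a cycle without
  being repeated.\<close>

definition linked :: "'a rel \<Rightarrow> 'a set \<Rightarrow> bool" where
  "linked r S \<longleftrightarrow> (\<forall>x\<in>S. \<forall>y\<in>S. (x, y) \<in> (r \<inter> S \<times> S)\<^sup>*)"

lemma linkedD: "linked r S \<Longrightarrow> x \<in> S \<Longrightarrow> y \<in> S \<Longrightarrow> (x, y) \<in> (r \<inter> S \<times> S)\<^sup>*"
  by (simp add: linked_def)

lemma linked_singleton: "linked r {a}"
  by (simp add: linked_def)

lemma linked_insert:
  assumes "linked r S" and "u \<in> S" and "(u, v) \<in> r" and "(v, u) \<in> r"
  shows "linked r (insert v S)"
proof -
  let ?r = "r \<inter> insert v S \<times> insert v S"
  have via_u: "(x, u) \<in> ?r\<^sup>* \<and> (u, x) \<in> ?r\<^sup>*" if "x \<in> insert v S" for x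
  proof (cases "x \<in> S")
    case True
    have "(r \<inter> S \<times> S)\<^sup>* \<subseteq> ?r\<^sup>*"
      by (intro rtrancl_mono) auto
    then show ?thesis
      using linkedD[OF assms(1)] True assms(2) by blast
  next
    case False
    then show ?thesis
      using that assms by auto
  qed
  show ?thesis
    unfolding linked_def using via_u by (meson rtrancl_trans)
qed

section \<open>Forests\<close>

context pair_wf_digraph
begin

text \<open>Shortening a walk to a path only discards arcs, so a walk with all arcs inside
  \<open>S\<close> yields a path inside \<open>S\<close>.\<close>

lemma rtrancl_imp_apath_in:
  assumes "(x, y) \<in> (parcs G \<inter> S \<times> S)\<^sup>*" and "y \<in> S" and "S \<subseteq> pverts G"
  obtains p where "apath x p y" "set (awalk_verts x p) \<subseteq> S"
proof -
  \<comment> \<open>The conjunct \<open>x \<in> S\<close> covers the empty walk, whose only vertex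
    is not seen by its arcs.\<close>
  have "\<exists>p. awalk x p y \<and> set p \<subseteq> S \<times> S \<and> x \<in> S"
    using assms(1)
  proof (induction rule: converse_rtrancl_induct)
    case base
    then show ?case
      using assms by (intro exI[of _ "[]"]) (auto simp: awalk_Nil_iff)
  next
    case (step a b)
    then obtain p where "awalk b p y" "set p \<subseteq> S \<times> S"
      by blast
    then show ?case
      using step by (intro exI[of _ "(a, b) # p"]) (auto simp: awalk_Cons_iff)
  qed
  then obtain p where p: "awalk x p y" "set p \<subseteq> S \<times> S" "x \<in> S"
    by blast
  let ?q = "awalk_to_apath p"
  have q: "apath x ?q y"
    using p(1) by (rule apath_awalk_to_apath)
  moreover have "set (awalk_verts x ?q) \<subseteq> S"
    using set_awalk_verts[OF awalkI_apath[OF q]] awalk_to_apath_subset[OF p(1)] p by fastforce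
  ultimately show ?thesis
    using that by blast
qed

text \<open>A path from \<open>a\<close> to \<open>b\<close> inside \<open>S\<close> is closed up
  through \<open>v\<close>. In a forest this limits a vertex outside a linked set to one neighbour
  in that set.\<close>

lemma cycle_through_new_vertex:
  assumes "linked (parcs G) S" and "S \<subseteq> pverts G" and "v \<notin> S"
    and "a \<in> S" and "b \<in> S" and "a \<noteq> b" and "(v, a) \<in> parcs G" and "(b, v) \<in> parcs G"
  obtains p where "cycle p" "3 \<le> length p"
proof -
  obtain q where q: "apath a q b" "set (awalk_verts a q) \<subseteq> S"
    using rtrancl_imp_apath_in linkedD assms by metis
  let ?p = "(v, a) # q @ [(b, v)]"
  have q': "awalk a q b" "distinct (awalk_verts a q)"
    using q(1) by (auto simp: apath_def)
  have bv: "awalk b [(b, v)] v"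
    using assms by (auto simp: awalk_simps wellformed')
  have w: "awalk a (q @ [(b, v)]) v"
    using q'(1) bv by (rule awalk_appendI)
  have "awalk v ?p v"
    using w assms by (simp add: awalk_Cons_iff del: awalk_append_iff)
  moreover have "awalk_verts a (q @ [(b, v)]) = awalk_verts a q @ [v]"
    using awalk_verts_append[OF w] q'(1) by simp
  then have "distinct (tl (awalk_verts v ?p))"
    using q' q(2) assms by auto
  \<comment> \<open>With the two arcs at \<open>v\<close>, a nonempty path gives length at least
    3.\<close>
  moreover have "q \<noteq> []"
    using q'(1) assms by (auto simp: awalk_Nil_iff)
  ultimately show ?thesis
    using that[of ?p] by (cases q) (auto simp: cycle_def)
qed

lemma cycle_triangle:
  assumes "(a, b) \<in> parcs G" "(b, c) \<in> parcs G" "(c, a) \<in> parcs G" "distinct [a, b, c]"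
  shows "cycle [(a, b), (b, c), (c, a)]"
  using assms by (auto simp: cycle_def awalk_simps wellformed' intro!: exI[of _ a])

end

text \<open>Connectedness disregards the direction of arcs; symmetry of the arcs turns it into
  directed reachability.\<close>

lemma undirected_tree_rtrancl:
  assumes "undirected_tree T" and "a \<in> pverts T" and "b \<in> pverts T"
  shows "(a, b) \<in> (parcs T)\<^sup>*"
proof -
  interpret pair_graph T
    using assms by (simp add: undirected_tree_def undirected_forest_def)
  have "a \<rightarrow>\<^sup>*\<^bsub>with_proj T\<^esub> b"
    using assms symmetric_connected_imp_strongly_connected[OF sym_arcs]
    by (auto simp: undirected_tree_def strongly_connected_def)
  then show ?thesis
    by (simp add: reachable_def rtrancl_on_rtranclI)
qed

section \<open>Short representations of subtrees\<close>

text \<open>The invariant of the leaf-by-leaf growth. Linkedness ensures that a new vertex has a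
  single neighbour in \<open>S\<close>, and the bound on the counts makes \<open>v u v\<close>
  alternate with the rest of the word. The form \<open>length w + 2\<close> avoids truncated
  subtraction.\<close>

definition short_rep :: "'a pair_pre_digraph \<Rightarrow> 'a set \<Rightarrow> 'a list \<Rightarrow> bool" where
  "short_rep T S w \<longleftrightarrow>
     S \<subseteq> pverts T \<and> linked (parcs T) S \<and> set w = S \<and>
     (\<forall>x\<in>S. \<forall>y\<in>S. x \<noteq> y \<longrightarrow> ((x, y) \<in> parcs T \<longleftrightarrow> alternate w x y)) \<and>
     (\<forall>x. count_list w x \<le> 2) \<and> length w + 2 = 2 * card S"

lemma (in pair_graph) short_rep_edge:
  assumes "(a, b) \<in> parcs G"
  shows "short_rep G {a, b} [a, b]"
proof -
  have "a \<noteq> b" "(b, a) \<in> parcs G"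
    using assms no_loops' arcs_symmetric by auto
  then show ?thesis
    using assms linked_insert[of "parcs G" "{a}" a b, OF linked_singleton] alternate_pair[of a b]
    by (auto simp: short_rep_def wellformed' insert_commute alternate_commute[of _ b a])
qed

lemma short_rep_insert_leaf:
  assumes forest: "undirected_forest T" and rep: "short_rep T S w"
    and uv: "(u, v) \<in> parcs T" and u: "u \<in> S" and v: "v \<notin> S"
  shows "\<exists>w'. short_rep T (insert v S) w'"
proof -
  interpret pair_graph T
    using forest by (simp add: undirected_forest_def)
  have S: "S \<subseteq> pverts T" "linked (parcs T) S" "set w = S" "length w + 2 = 2 * card S"
    and adj: "\<And>x y. x \<in> S \<Longrightarrow> y \<in> S \<Longrightarrow> x \<noteq> y \<Longrightarrow> (x, y) \<in> parcs T \<longleftrightarrow> alternate w x y"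
    and cnt: "\<And>x. count_list w x \<le> 2"
    using rep by (auto simp: short_rep_def)
  have vu: "(v, u) \<in> parcs T"
    using uv by (rule arcs_symmetric)
  \<comment> \<open>A second neighbour of \<open>v\<close> in \<open>S\<close> would, together with
    \<open>u\<close>, give a cycle through \<open>v\<close>.\<close>
  have nbr: "(v, x) \<in> parcs T \<longleftrightarrow> x = u" if "x \<in> S" for x
    using cycle_through_new_vertex[of S v x u] that forest S uv vu u v
    by (auto simp: undirected_forest_def)
  obtain A B where w: "w = A @ u # B" and A: "u \<notin> set A"
    using split_list_first[of u w] S(3) u by blast
  define w' where "w' = A @ v # u # v # B"
  have "v \<noteq> u" "v \<notin> set w"
    using u v S(3) by auto
  have leaf: "(v, x) \<in> parcs T \<longleftrightarrow> alternate w' v x" if "x \<in> S" for x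
  proof (cases "x = u")
    case True
    \<comment> \<open>One of the at most two occurrences of \<open>u\<close> is the one in front of
      \<open>B\<close>.\<close>
    have "count_list B u \<le> 1"
      using cnt[of u] by (simp add: w)
    then show ?thesis
      using True uv vu alternate_leaf[of v A u B] A \<open>v \<notin> set w\<close> by (simp add: w w'_def)
  next
    case False
    then show ?thesis
      using nbr that not_alternate_leaf[of x u v A B] \<open>v \<noteq> u\<close> by (simp add: w'_def)
  qed
  have old: "(x, y) \<in> parcs T \<longleftrightarrow> alternate w' x y" if "x \<in> S" "y \<in> S" "x \<noteq> y" for x y
    using that v adj alternate_insert_leaf[of x v y A u B] by (auto simp: w w'_def)
  have "(x, v) \<in> parcs T \<longleftrightarrow> alternate w' x v" if "x \<in> S" for x
    using leaf[OF that] arcs_symmetric alternate_commute[of w' x v] by blast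
  with leaf old have "\<forall>x\<in>insert v S. \<forall>y\<in>insert v S. x \<noteq> y \<longrightarrow>
      ((x, y) \<in> parcs T \<longleftrightarrow> alternate w' x y)"
    by blast
  moreover have "count_list w' x \<le> 2" for x
    using cnt[of x] \<open>v \<notin> set w\<close> by (auto simp: w w'_def)
  moreover have "length w' + 2 = 2 * card (insert v S)"
    using S v finite_subset[OF S(1) pair_finite_verts] by (simp add: w w'_def)
  moreover have "set w' = insert v S"
    using S(3) by (auto simp: w w'_def)
  moreover have "linked (parcs T) (insert v S)"
    using S(2) u uv vu by (rule linked_insert)
  moreover have "insert v S \<subseteq> pverts T"
    using S(1) uv by (auto simp: wellformed')
  ultimately show ?thesis
    unfolding short_rep_def by blast
qed

lemma ex_short_rep:
  assumes tree: "undirected_tree T" and "2 \<le> k" and "k \<le> card (pverts T)"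
  shows "\<exists>S w. card S = k \<and> short_rep T S w"
  using assms(2,3)
proof (induction k rule: dec_induct)
  case base
  interpret pair_graph T
    using tree by (simp add: undirected_tree_def undirected_forest_def)
  obtain a b where "a \<in> pverts T" "b \<in> pverts T" "a \<noteq> b"
    using base by (meson card_2_iff' obtain_subset_with_card_n subsetD)
  \<comment> \<open>The starting edge is the first arc of a walk between two distinct
    vertices.\<close>
  then obtain x y where "(x, y) \<in> parcs T"
    using undirected_tree_rtrancl[OF tree, of a b] by (auto elim: converse_rtranclE)
  moreover from this have "x \<noteq> y"
    by (rule no_loops')
  ultimately show ?case
    using short_rep_edge card_2_iff by metis
next
  case (step k)
  interpret pair_graph T
    using tree by (simp add: undirected_tree_def undirected_forest_def)
  obtain S w where S: "card S = k" "short_rep T S w"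
    using step by auto
  have "S \<subset> pverts T" "S \<noteq> {}"
    using S step by (auto simp: short_rep_def)
  then obtain a b where "a \<in> S" "b \<in> pverts T" "b \<notin> S" "a \<in> pverts T"
    by blast
  \<comment> \<open>A walk from inside \<open>S\<close> to a vertex outside must leave
    \<open>S\<close> along some arc, whose head is the next leaf.\<close>
  then obtain u v where uv: "(u, v) \<in> parcs T" "u \<in> S" "v \<notin> S"
    using rtrancl_crossing_pair[OF undirected_tree_rtrancl[OF tree, of a b]] by blast
  then obtain w' where "short_rep T (insert v S) w'"
    using short_rep_insert_leaf[of T S w u v] tree S by (auto simp: undirected_tree_def)
  moreover have "card (insert v S) = Suc k"
    using uv S finite_subset[OF psubset_imp_subset[OF \<open>S \<subset> pverts T\<close>] pair_finite_verts] by simp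
  ultimately show ?case
    by blast
qed

lemma ex_short_word:
  assumes "undirected_tree T" and "2 \<le> card (pverts T)"
  obtains w where "word_represents w T" "length w = 2 * card (pverts T) - 2"
proof -
  interpret pair_graph T
    using assms by (simp add: undirected_tree_def undirected_forest_def)
  obtain S w where S: "card S = card (pverts T)" "short_rep T S w"
    using ex_short_rep assms by blast
  then have "S = pverts T"
    using card_subset_eq[OF pair_finite_verts] by (auto simp: short_rep_def)
  then show ?thesis
    using S that[of w] by (auto simp: short_rep_def word_represents_def)
qed

section \<open>The lower bound\<close>

lemma card_le_2I:
  assumes "\<And>x y z. x \<in> A \<Longrightarrow> y \<in> A \<Longrightarrow> z \<in> A \<Longrightarrow> distinct [x, y, z] \<Longrightarrow> False"
  shows "card A \<le> 2"
proof (rule ccontr)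
  assume "\<not> card A \<le> 2"
  then obtain B where "B \<subseteq> A" "card B = 3"
    by (metis obtain_subset_with_card_n not_less_eq_eq numeral_2_eq_2 numeral_3_eq_3)
  then obtain x y z where "{x, y, z} \<subseteq> A" "distinct [x, y, z]"
    by (auto simp: card_3_iff)
  then show False
    using assms[of x y z] by simp
qed

lemma length_word_represents_forest:
  assumes forest: "undirected_forest T" and rep: "word_represents w T"
  shows "2 * card (pverts T) - 2 \<le> length w"
proof -
  interpret pair_graph T
    using forest by (simp add: undirected_forest_def)
  define U where "U = {x \<in> pverts T. count_list w x = 1}"
  \<comment> \<open>So \<open>U\<close> is a clique, and three of its vertices would form a cycle of
    length 3.\<close>
  have adj: "(x, y) \<in> parcs T" if "x \<in> U" "y \<in> U" "x \<noteq> y" for x y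
    using that rep alternate_if_count_list_eq_1[of w x y] by (auto simp: U_def word_represents_def)
  have "card U \<le> 2"
  proof (rule card_le_2I)
    fix x y z assume "x \<in> U" "y \<in> U" "z \<in> U" "distinct [x, y, z]"
    then have "cycle [(x, y), (y, z), (z, x)]"
      by (intro cycle_triangle) (auto intro: adj)
    then show False
      using forest by (auto simp: undirected_forest_def)
  qed
  have "2 * card (pverts T) = (\<Sum>x\<in>pverts T. 2)"
    by simp
  \<comment> \<open>Every vertex occurs in \<open>w\<close>, so one extra unit for each member of
    \<open>U\<close> lifts all counts to at least 2. The counts sum to \<open>length w\<close> and
    the extra units to \<open>card U\<close>.\<close>
  also have "\<dots> \<le> (\<Sum>x\<in>pverts T. count_list w x + (if x \<in> U then 1 else 0))"
  proof (rule sum_mono)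
    fix x assume "x \<in> pverts T"
    then have "count_list w x \<noteq> 0"
      using rep by (simp add: count_list_0_iff word_represents_def)
    then show "2 \<le> count_list w x + (if x \<in> U then 1 else 0)"
      using \<open>x \<in> pverts T\<close> by (auto simp: U_def)
  qed
  also have "\<dots> = length w + card (pverts T \<inter> U)"
    using rep pair_finite_verts
    by (simp add: sum.distrib sum_count_set word_represents_def flip: sum.inter_restrict)
  also have "pverts T \<inter> U = U"
    by (auto simp: U_def)
  finally show ?thesis
    using \<open>card U \<le> 2\<close> by linarith
qed

theorem theorem3:
  fixes T :: "'a pair_pre_digraph"
  assumes "undirected_tree T"
    and "card (pverts T) \<ge> 2"
  shows "word_representable T \<and> min_word_length T = 2 * card (pverts T) - 2"
proof -
  obtain w where w: "word_represents w T" "length w = 2 * card (pverts T) - 2"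
    using ex_short_word assms by blast
  have "min_word_length T = 2 * card (pverts T) - 2"
    unfolding min_word_length_def
    using w length_word_represents_forest assms by (intro Least_equality) (auto simp: undirected_tree_def)
  with w show ?thesis
    by (auto simp: word_representable_def)
qed

end
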